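(* Consider the log-linearized general equilibrium system described in the context, and let $$B\equiv \theta_{RK}+\alpha_R\theta_{RQ},\qquad C\equiv \alpha_X\theta_{ER}\sigma_X+(\alpha_F+\alpha_X\theta_{EF})\sigma_E .$$ Let $\hat s>0$, and suppose $\sigma_R\neq0$ and $\sigma_X\neq0$ (implying $C\neq0$). Then, holding all other parameters fixed, there exist values of $\sigma_E>0$ such that the solution of the system has $\hat F>0$. Furthermore, the range of values $\sigma_E$ leading to $\hat F>0$ is given by $$\frac{\theta_{RK}C}{B}>\sigma_E\ge 0,$$ (where $C$ is evaluated at that same $\sigma_E$), and $\hat F<0$ if and only if $\sigma_E>\frac{\theta_{RK}C}{B}>0$.
   Context: Initial equilibrium. The following level values are positive reals: capital uses $K_X,K_R,K_F$ with $\bar K=K_X+K_R+K_F$; a fixed factor $\bar Q$; quantities $X$ (final good), $E$ (energy), $R$ (renewable energy), $F$ (fossil energy, $F=K_F$); prices $P_X=1,P_E,P_R,P_F,P_K,P_Q$; an ad valorem capital tax $t$ and a per-unit offset payment $s$. They satisfy the zero-profit conditions $P_XX=(1+t)P_KK_X+P_EE$, $P_EE=P_FF+P_RR$, $(P_R+s)R=(1+t)P_KK_R+P_Q\bar Q$, $P_FF=(1+t)P_KK_F$, and the balanced government budget $tP_K\bar K=sR$. Share parameters: $\alpha_i=K_i/\bar K$ for $i\in\{X,R,F\}$; $\theta_{XK}=\frac{(1+t)P_KK_X}{P_XX}$, $\theta_{XE}=\frac{P_EE}{P_XX}$, $\theta_{EF}=\frac{P_FF}{P_EE}$, $\theta_{ER}=\frac{P_RR}{P_EE}$,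 $\theta_{RK}=\frac{(1+t)P_KK_R}{(P_R+s)R}$, $\theta_{RQ}=\frac{P_Q\bar Q}{(P_R+s)R}$, $\gamma=\frac{s}{P_R+s}$, $\psi=\frac{1+t}{t}$. Elasticities of substitution $\sigma_X,\sigma_E,\sigma_R\ge 0$ are parameters that can be varied independently of the shares. Log-linear system. Hatted variables denote small proportional changes and are the real unknowns of a linear system ($\hat t=dt/(1+t)$, $\hat s=ds/s$). Given exogenous $\hat s$, the 14 unknowns $\hat K_X,\hat K_R,\hat K_F,\hat X,\hat E,\hat F,\hat R,\hat P_K,\hat P_X,\hat P_E,\hat P_F,\hat P_R,\hat P_Q,\hat t$ solve the 14 equations: $0=\alpha_X\hat K_X+\alpha_R\hat K_R+\alpha_F\hat K_F$; $\hat X=\theta_{XK}\hat K_X+\theta_{XE}\hat E$; $\hat P_X+\hat X=\theta_{XK}(\hat t+\hat P_K+\hat K_X)+\theta_{XE}(\hat P_E+\hat E)$; $\hat K_X-\hat E=\sigma_X(\hat P_E-\hat t-\hat P_K)$; $\hat E=\theta_{EF}\hat F+\theta_{ER}\hat R$; $\hat P_E+\hat E=\theta_{EF}(\hat P_F+\hat F)+\theta_{ER}(\hat P_R+\hat R)$; $\hat R-\hat F=\sigma_E(\hat P_F-\hat P_R)$; $\hat R=\theta_{RK}\hat K_R$; $(1-\gamma)\hat P_R+\gamma\hat s+\hat R=\theta_{RK}(\hat t+\hat P_K+\hat K_R)+\theta_{RQ}\hat P_Q$; $\hat K_R=\sigma_R(\hat P_Q-\hat t-\hat P_K)$; $\hat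 F=\hat K_F$; $\hat P_F+\hat F=\hat t+\hat P_K+\hat K_F$; $\hat s+\hat R=\psi\hat t+\hat P_K$; $\hat P_X=0$. *)

theory Defs
  imports Complex_Main
begin

text \<open>
  Level values of the initial equilibrium.  \<open>Qbar\<close> is the fixed factor, \<open>tax\<close> is the ad valorem
  capital tax \<open>t\<close>, and \<open>offset\<close> is the per-unit offset payment \<open>s\<close>.
\<close>

record levels =
  KX :: real
  KR :: real
  KF :: real
  Qbar :: real
  qX :: real
  qE :: real
  qR :: real
  qF :: real
  PX :: real
  PE :: real
  PR :: real
  PF :: real
  PK :: real
  PQ :: real
  tax :: real
  offset :: real

definition Kbar :: "levels \<Rightarrow> real" where
  "Kbar e = KX e + KR e + KF e"

definition initial_equilibrium :: "levels \<Rightarrow> bool" where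
  "initial_equilibrium e \<longleftrightarrow>
     KX e > 0 \<and> KR e > 0 \<and> KF e > 0 \<and> Qbar e > 0 \<and>
     qX e > 0 \<and> qE e > 0 \<and> qR e > 0 \<and> qF e > 0 \<and>
     PX e > 0 \<and> PE e > 0 \<and> PR e > 0 \<and> PF e > 0 \<and> PK e > 0 \<and> PQ e > 0 \<and>
     tax e > 0 \<and> offset e > 0 \<and>
     qF e = KF e \<and>
     PX e = 1 \<and>
     PX e * qX e = (1 + tax e) * PK e * KX e + PE e * qE e \<and>
     PE e * qE e = PF e * qF e + PR e * qR e \<and>
     (PR e + offset e) * qR e = (1 + tax e) * PK e * KR e + PQ e * Qbar e \<and>
     PF e * qF e = (1 + tax e) * PK e * KF e \<and>
     tax e * PK e * Kbar e = offset e * qR e"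

definition \<alpha>\<^sub>X :: "levels \<Rightarrow> real" where "\<alpha>\<^sub>X e = KX e / Kbar e"
definition \<alpha>\<^sub>R :: "levels \<Rightarrow> real" where "\<alpha>\<^sub>R e = KR e / Kbar e"
definition \<alpha>\<^sub>F :: "levels \<Rightarrow> real" where "\<alpha>\<^sub>F e = KF e / Kbar e"

definition \<theta>\<^sub>X\<^sub>K :: "levels \<Rightarrow> real" where
  "\<theta>\<^sub>X\<^sub>K e = (1 + tax e) * PK e * KX e / (PX e * qX e)"
definition \<theta>\<^sub>X\<^sub>E :: "levels \<Rightarrow> real" where
  "\<theta>\<^sub>X\<^sub>E e = PE e * qE e / (PX e * qX e)"
definition \<theta>\<^sub>E\<^sub>F :: "levels \<Rightarrow> real" where
  "\<theta>\<^sub>E\<^sub>F e = PF e * qF e / (PE e * qE e)"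
definition \<theta>\<^sub>E\<^sub>R :: "levels \<Rightarrow> real" where
  "\<theta>\<^sub>E\<^sub>R e = PR e * qR e / (PE e * qE e)"
definition \<theta>\<^sub>R\<^sub>K :: "levels \<Rightarrow> real" where
  "\<theta>\<^sub>R\<^sub>K e = (1 + tax e) * PK e * KR e / ((PR e + offset e) * qR e)"
definition \<theta>\<^sub>R\<^sub>Q :: "levels \<Rightarrow> real" where
  "\<theta>\<^sub>R\<^sub>Q e = PQ e * Qbar e / ((PR e + offset e) * qR e)"

definition \<gamma> :: "levels \<Rightarrow> real" where
  "\<gamma> e = offset e / (PR e + offset e)"
definition \<psi> :: "levels \<Rightarrow> real" where
  "\<psi> e = (1 + tax e) / tax e"

text \<open>
  The endogenous proportional changes.  Note that \<open>hat_t\<close> stands for \<open>dt / (1 + t)\<close>, whereas the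
  other hats are relative changes of the form \<open>dx / x\<close>.
\<close>

record changes =
  hat_KX :: real
  hat_KR :: real
  hat_KF :: real
  hat_X :: real
  hat_E :: real
  hat_F :: real
  hat_R :: real
  hat_PK :: real
  hat_PX :: real
  hat_PE :: real
  hat_PF :: real
  hat_PR :: real
  hat_PQ :: real
  hat_t :: real

definition loglinear_system ::
  "levels \<Rightarrow> real \<Rightarrow> real \<Rightarrow> real \<Rightarrow> real \<Rightarrow> changes \<Rightarrow> bool" where
  "loglinear_system e \<sigma>\<^sub>X \<sigma>\<^sub>E \<sigma>\<^sub>R hat_s u \<longleftrightarrow>
     0 = \<alpha>\<^sub>X e * hat_KX u + \<alpha>\<^sub>R e * hat_KR u + \<alpha>\<^sub>F e * hat_KF u \<and>
     hat_X u = \<theta>\<^sub>X\<^sub>K e * hat_KX u + \<theta>\<^sub>X\<^sub>E e * hat_E u \<and>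
     hat_PX u + hat_X u =
       \<theta>\<^sub>X\<^sub>K e * (hat_t u + hat_PK u + hat_KX u) + \<theta>\<^sub>X\<^sub>E e * (hat_PE u + hat_E u) \<and>
     hat_KX u - hat_E u = \<sigma>\<^sub>X * (hat_PE u - hat_t u - hat_PK u) \<and>
     hat_E u = \<theta>\<^sub>E\<^sub>F e * hat_F u + \<theta>\<^sub>E\<^sub>R e * hat_R u \<and>
     hat_PE u + hat_E u =
       \<theta>\<^sub>E\<^sub>F e * (hat_PF u + hat_F u) + \<theta>\<^sub>E\<^sub>R e * (hat_PR u + hat_R u) \<and>
     hat_R u - hat_F u = \<sigma>\<^sub>E * (hat_PF u - hat_PR u) \<and>
     hat_R u = \<theta>\<^sub>R\<^sub>K e * hat_KR u \<and>
     (1 - \<gamma> e) * hat_PR u + \<gamma> e * hat_s + hat_R u =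
       \<theta>\<^sub>R\<^sub>K e * (hat_t u + hat_PK u + hat_KR u) + \<theta>\<^sub>R\<^sub>Q e * hat_PQ u \<and>
     hat_KR u = \<sigma>\<^sub>R * (hat_PQ u - hat_t u - hat_PK u) \<and>
     hat_F u = hat_KF u \<and>
     hat_PF u + hat_F u = hat_t u + hat_PK u + hat_KF u \<and>
     hat_s + hat_R u = \<psi> e * hat_t u + hat_PK u \<and>
     hat_PX u = 0"

text \<open>
  Meaningful only where the system is uniquely solvable; unique solvability has to be
  established separately wherever \<open>solution\<close> is used.
\<close>

definition solution :: "levels \<Rightarrow> real \<Rightarrow> real \<Rightarrow> real \<Rightarrow> real \<Rightarrow> changes" where
  "solution e \<sigma>\<^sub>X \<sigma>\<^sub>E \<sigma>\<^sub>R hat_s = (THE u. loglinear_system e \<sigma>\<^sub>X \<sigma>\<^sub>E \<sigma>\<^sub>R hat_s u)"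

definition coeff_B :: "levels \<Rightarrow> real" where
  "coeff_B e = \<theta>\<^sub>R\<^sub>K e + \<alpha>\<^sub>R e * \<theta>\<^sub>R\<^sub>Q e"

definition coeff_C :: "levels \<Rightarrow> real \<Rightarrow> real \<Rightarrow> real" where
  "coeff_C e \<sigma>\<^sub>X \<sigma>\<^sub>E =
     \<alpha>\<^sub>X e * \<theta>\<^sub>E\<^sub>R e * \<sigma>\<^sub>X + (\<alpha>\<^sub>F e + \<alpha>\<^sub>X e * \<theta>\<^sub>E\<^sub>F e) * \<sigma>\<^sub>E"

end

theory Submission imports Defs begin

text \<open>
  Let \<open>p\<close> be the change of the renewable price relative to the tax-inclusive capital price.  The
  price equations are linear in \<open>p\<close>, and substituting them into the capital constraint gives
  \<open>B * hat_KR = - C * p\<close>, hence \<open>hat_F = p * (\<sigma>\<^sub>E - \<theta>\<^sub>R\<^sub>K * C / B)\<close>.  The zero-profit condition of the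
  renewable sector then determines \<open>p\<close> as a negative multiple of \<open>hat_s\<close>, so the sign of \<open>hat_F\<close>
  is that of \<open>\<theta>\<^sub>R\<^sub>K * C / B - \<sigma>\<^sub>E\<close>.
\<close>

text \<open>The pairs of cost shares sum to one because each is the zero-profit identity of its
  sector divided by revenue. Strictness of \<open>\<psi> e > 1\<close> matters:
  \<open>\<psi> e - 1\<close> is the divisor when \<open>hat_t\<close> is recovered from the
  government budget.\<close>

lemma initial_equilibrium_shares:
  assumes "initial_equilibrium e"
  shows "\<alpha>\<^sub>X e > 0" "\<alpha>\<^sub>R e > 0" "\<alpha>\<^sub>F e > 0" "\<alpha>\<^sub>X e + \<alpha>\<^sub>R e + \<alpha>\<^sub>F e = 1"
    and "\<theta>\<^sub>X\<^sub>K e > 0" "\<theta>\<^sub>X\<^sub>E e > 0" "\<theta>\<^sub>X\<^sub>K e + \<theta>\<^sub>X\<^sub>E e = 1"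
    and "\<theta>\<^sub>E\<^sub>F e > 0" "\<theta>\<^sub>E\<^sub>R e > 0" "\<theta>\<^sub>E\<^sub>F e + \<theta>\<^sub>E\<^sub>R e = 1"
    and "\<theta>\<^sub>R\<^sub>K e > 0" "\<theta>\<^sub>R\<^sub>Q e > 0" "\<theta>\<^sub>R\<^sub>K e + \<theta>\<^sub>R\<^sub>Q e = 1"
    and "\<gamma> e > 0" "\<gamma> e < 1" "\<psi> e > 1"
proof -
  note eq = assms[unfolded initial_equilibrium_def]
  have Kbar: "Kbar e > 0"
    using eq by (simp add: Kbar_def)
  show "\<alpha>\<^sub>X e > 0" "\<alpha>\<^sub>R e > 0" "\<alpha>\<^sub>F e > 0"
    using eq Kbar by (simp_all add: \<alpha>\<^sub>X_def \<alpha>\<^sub>R_def \<alpha>\<^sub>F_def)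
  show "\<alpha>\<^sub>X e + \<alpha>\<^sub>R e + \<alpha>\<^sub>F e = 1"
    using Kbar by (simp add: \<alpha>\<^sub>X_def \<alpha>\<^sub>R_def \<alpha>\<^sub>F_def Kbar_def flip: add_divide_distrib)
  have X: "PX e * qX e > 0" and E: "PE e * qE e > 0" and R: "(PR e + offset e) * qR e > 0"
    using eq by (intro mult_pos_pos add_pos_pos; simp)+
  have X_eq: "PX e * qX e = (1 + tax e) * PK e * KX e + PE e * qE e"
    and E_eq: "PE e * qE e = PF e * qF e + PR e * qR e"
    and R_eq: "(PR e + offset e) * qR e = (1 + tax e) * PK e * KR e + PQ e * Qbar e"
    using eq by blast+
  show "\<theta>\<^sub>X\<^sub>K e > 0" "\<theta>\<^sub>X\<^sub>E e > 0" "\<theta>\<^sub>E\<^sub>F e > 0" "\<theta>\<^sub>E\<^sub>R e > 0" "\<theta>\<^sub>R\<^sub>K e > 0" "\<theta>\<^sub>R\<^sub>Q e > 0"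
    unfolding \<theta>\<^sub>X\<^sub>K_def \<theta>\<^sub>X\<^sub>E_def \<theta>\<^sub>E\<^sub>F_def \<theta>\<^sub>E\<^sub>R_def \<theta>\<^sub>R\<^sub>K_def \<theta>\<^sub>R\<^sub>Q_def
    using eq by (intro divide_pos_pos mult_pos_pos add_pos_pos; simp)+
  have "\<theta>\<^sub>X\<^sub>K e + \<theta>\<^sub>X\<^sub>E e = PX e * qX e / (PX e * qX e)"
    by (simp only: \<theta>\<^sub>X\<^sub>K_def \<theta>\<^sub>X\<^sub>E_def X_eq flip: add_divide_distrib)
  then show "\<theta>\<^sub>X\<^sub>K e + \<theta>\<^sub>X\<^sub>E e = 1"
    using X by (metis divide_self less_irrefl)
  have "\<theta>\<^sub>E\<^sub>F e + \<theta>\<^sub>E\<^sub>R e = PE e * qE e / (PE e * qE e)"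
    by (simp only: \<theta>\<^sub>E\<^sub>F_def \<theta>\<^sub>E\<^sub>R_def E_eq flip: add_divide_distrib)
  then show "\<theta>\<^sub>E\<^sub>F e + \<theta>\<^sub>E\<^sub>R e = 1"
    using E by (metis divide_self less_irrefl)
  have "\<theta>\<^sub>R\<^sub>K e + \<theta>\<^sub>R\<^sub>Q e = (PR e + offset e) * qR e / ((PR e + offset e) * qR e)"
    by (simp only: \<theta>\<^sub>R\<^sub>K_def \<theta>\<^sub>R\<^sub>Q_def R_eq flip: add_divide_distrib)
  then show "\<theta>\<^sub>R\<^sub>K e + \<theta>\<^sub>R\<^sub>Q e = 1"
    using R by (metis divide_self less_irrefl)
  show "\<gamma> e > 0" "\<gamma> e < 1" "\<psi> e > 1"
    using eq by (simp_all add: \<gamma>_def \<psi>_def)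
qed

text \<open>One value of \<open>\<sigma>\<^sub>E\<close> is fixed here, so the system can be solved
  once; the theorem then interprets the locale at every nonnegative value.\<close>

locale renewable_subsidy =
  fixes e :: levels and \<sigma>\<^sub>X \<sigma>\<^sub>E \<sigma>\<^sub>R hat_s :: real
  assumes equilibrium: "initial_equilibrium e"
    and \<sigma>\<^sub>X_pos: "\<sigma>\<^sub>X > 0" and \<sigma>\<^sub>E_nonneg: "\<sigma>\<^sub>E \<ge> 0" and \<sigma>\<^sub>R_pos: "\<sigma>\<^sub>R > 0"
    and hat_s_pos: "hat_s > 0"
begin

lemmas shares = initial_equilibrium_shares[OF equilibrium]

abbreviation "B \<equiv> coeff_B e"
abbreviation "C \<equiv> coeff_C e \<sigma>\<^sub>X \<sigma>\<^sub>E"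

lemma B_pos: "B > 0"
  unfolding coeff_B_def using shares by (simp add: add_pos_pos)

lemma C_pos: "C > 0"
  unfolding coeff_C_def using shares \<sigma>\<^sub>X_pos \<sigma>\<^sub>E_nonneg by (simp add: add_pos_nonneg)

text \<open>The closed form of \<open>hat_PR - hat_t - hat_PK\<close>. The denominator collects
  three effects of this price in the renewable zero-profit condition: the direct one, the feedback
  through the capital price, and the return to the fixed factor.\<close>

definition relative_price :: real where
  "relative_price = - \<gamma> e * hat_s /
     ((1 - \<gamma> e) + \<gamma> e * \<theta>\<^sub>X\<^sub>E e * \<theta>\<^sub>E\<^sub>R e + \<theta>\<^sub>R\<^sub>Q e * C / (B * \<sigma>\<^sub>R))"

lemma denominator_pos:
  "(1 - \<gamma> e) + \<gamma> e * \<theta>\<^sub>X\<^sub>E e * \<theta>\<^sub>E\<^sub>R e + \<theta>\<^sub>R\<^sub>Q e * C / (B * \<sigma>\<^sub>R) > 0"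
  using shares B_pos C_pos \<sigma>\<^sub>R_pos by (intro add_pos_pos divide_pos_pos mult_pos_pos) simp_all

lemma relative_price_neg: "relative_price < 0"
  unfolding relative_price_def
  using denominator_pos shares hat_s_pos by (intro divide_neg_pos) simp_all

text \<open>The right-hand side is the renewable zero-profit condition with all other unknowns
  eliminated. Since the coefficient of \<open>p\<close> is positive, it has exactly one root;
  existence and uniqueness of the solution each use one direction.\<close>

lemma eq_relative_price_iff:
  "p = relative_price \<longleftrightarrow>
    (1 - \<gamma> e) * p + \<gamma> e * \<theta>\<^sub>X\<^sub>E e * \<theta>\<^sub>E\<^sub>R e * p + \<gamma> e * hat_s = \<theta>\<^sub>R\<^sub>Q e * ((- C * p / B) / \<sigma>\<^sub>R)"
proof -
  have "p = relative_price \<longleftrightarrow>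
    p * ((1 - \<gamma> e) + \<gamma> e * \<theta>\<^sub>X\<^sub>E e * \<theta>\<^sub>E\<^sub>R e + \<theta>\<^sub>R\<^sub>Q e * C / (B * \<sigma>\<^sub>R)) = - \<gamma> e * hat_s"
    unfolding relative_price_def by (rule nonzero_eq_divide_eq) (use denominator_pos in linarith)
  then show ?thesis
    by (simp add: algebra_simps)
qed

text \<open>Back substitution, starting from \<open>p\<close>. Here \<open>w\<close> is
  \<open>hat_t + hat_PK\<close>; outside the government budget these two unknowns occur only through
  this sum, so the budget is left to split \<open>w\<close> into its summands.\<close>

definition equilibrium_response :: changes where
  "equilibrium_response =
    (let p = relative_price; w = - \<theta>\<^sub>X\<^sub>E e * \<theta>\<^sub>E\<^sub>R e * p; kr = - C * p / B; r = \<theta>\<^sub>R\<^sub>K e * kr;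
         f = r + \<sigma>\<^sub>E * p; en = \<theta>\<^sub>E\<^sub>F e * f + \<theta>\<^sub>E\<^sub>R e * r; kx = en + \<sigma>\<^sub>X * \<theta>\<^sub>E\<^sub>R e * p;
         t = (hat_s + r - w) / (\<psi> e - 1)
     in \<lparr>hat_KX = kx, hat_KR = kr, hat_KF = f, hat_X = \<theta>\<^sub>X\<^sub>K e * kx + \<theta>\<^sub>X\<^sub>E e * en, hat_E = en,
         hat_F = f, hat_R = r, hat_PK = w - t, hat_PX = 0, hat_PE = w + \<theta>\<^sub>E\<^sub>R e * p, hat_PF = w,
         hat_PR = w + p, hat_PQ = w + kr / \<sigma>\<^sub>R, hat_t = t\<rparr>)"

lemma loglinear_system_equilibrium_response:
  "loglinear_system e \<sigma>\<^sub>X \<sigma>\<^sub>E \<sigma>\<^sub>R hat_s equilibrium_response"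
proof -
  define p where "p = relative_price"
  define w where "w = - \<theta>\<^sub>X\<^sub>E e * \<theta>\<^sub>E\<^sub>R e * p"
  define kr where "kr = - C * p / B"
  define r where "r = \<theta>\<^sub>R\<^sub>K e * kr"
  define f where "f = r + \<sigma>\<^sub>E * p"
  define en where "en = \<theta>\<^sub>E\<^sub>F e * f + \<theta>\<^sub>E\<^sub>R e * r"
  define kx where "kx = en + \<sigma>\<^sub>X * \<theta>\<^sub>E\<^sub>R e * p"
  define t where "t = (hat_s + r - w) / (\<psi> e - 1)"
  define q where "q = kr / \<sigma>\<^sub>R"
  have response: "equilibrium_response =
    \<lparr>hat_KX = kx, hat_KR = kr, hat_KF = f, hat_X = \<theta>\<^sub>X\<^sub>K e * kx + \<theta>\<^sub>X\<^sub>E e * en, hat_E = en,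
     hat_F = f, hat_R = r, hat_PK = w - t, hat_PX = 0, hat_PE = w + \<theta>\<^sub>E\<^sub>R e * p, hat_PF = w,
     hat_PR = w + p, hat_PQ = w + q, hat_t = t\<rparr>"
    unfolding equilibrium_response_def Let_def p_def w_def kr_def r_def f_def en_def kx_def t_def
      q_def by simp
  have kr: "B * kr = - C * p"
    unfolding kr_def using B_pos by simp
  have q: "kr = \<sigma>\<^sub>R * q"
    unfolding q_def using \<sigma>\<^sub>R_pos by simp
  have t: "hat_s + r = \<psi> e * t + (w - t)"
  proof -
    have "(\<psi> e - 1) * t = hat_s + r - w"
      unfolding t_def using shares(16) by simp
    then show ?thesis
      by (simp add: algebra_simps)
  qed
  have zero_profit:
    "(1 - \<gamma> e) * p + \<gamma> e * \<theta>\<^sub>X\<^sub>E e * \<theta>\<^sub>E\<^sub>R e * p + \<gamma> e * hat_s = \<theta>\<^sub>R\<^sub>Q e * q"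
    using eq_relative_price_iff[of p] unfolding q_def kr_def p_def by simp
  \<comment> \<open>By the share identities, the right-hand side collapses to
    \<open>B * kr + C * p\<close>: the coefficient of \<open>kr\<close> is
    \<open>\<theta>\<^sub>R\<^sub>K * (1 - \<alpha>\<^sub>R) + \<alpha>\<^sub>R\<close>, which
    equals \<open>B\<close>.\<close>
  have capital: "0 = \<alpha>\<^sub>X e * kx + \<alpha>\<^sub>R e * kr + \<alpha>\<^sub>F e * f"
    using kr shares(4,10,13) unfolding coeff_B_def coeff_C_def kx_def en_def f_def r_def
    by algebra
  have final: "0 = \<theta>\<^sub>X\<^sub>K e * w + \<theta>\<^sub>X\<^sub>E e * (w + \<theta>\<^sub>E\<^sub>R e * p)"
    using shares(7) unfolding w_def by algebra
  \<comment> \<open>The output change \<open>r\<close> cancels against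
    \<open>\<theta>\<^sub>R\<^sub>K e * kr\<close>, and the shares sum to one, which leaves
    \<open>zero_profit\<close> with \<open>- \<gamma> e * w\<close> written in terms of
    \<open>p\<close>.\<close>
  have renewable: "(1 - \<gamma> e) * (w + p) + \<gamma> e * hat_s + r =
      \<theta>\<^sub>R\<^sub>K e * (w + kr) + \<theta>\<^sub>R\<^sub>Q e * (w + q)"
    using zero_profit shares(13) unfolding w_def r_def by algebra
  have energy: "w + \<theta>\<^sub>E\<^sub>R e * p + en = \<theta>\<^sub>E\<^sub>F e * (w + f) + \<theta>\<^sub>E\<^sub>R e * (w + p + r)"
    using shares(10) unfolding en_def by algebra
  show ?thesis
    unfolding loglinear_system_def response
    using capital final renewable energy t q
    by (simp add: f_def kx_def r_def en_def algebra_simps)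
qed

text \<open>Each equation forces one field of \<open>u\<close> in terms of \<open>w\<close>,
  \<open>p\<close> and fields already determined, and \<open>p\<close> itself is forced by the
  renewable sector.\<close>

lemma loglinear_system_imp_equilibrium_response:
  assumes "loglinear_system e \<sigma>\<^sub>X \<sigma>\<^sub>E \<sigma>\<^sub>R hat_s u"
  shows "u = equilibrium_response"
proof -
  note sys = assms[unfolded loglinear_system_def]
  define w where "w = hat_t u + hat_PK u"
  define p where "p = hat_PR u - w"
  have PF: "hat_PF u = w"
    using sys unfolding w_def by linarith
  have PE: "hat_PE u = w + \<theta>\<^sub>E\<^sub>R e * p"
  proof -
    have "hat_PE u = \<theta>\<^sub>E\<^sub>F e * w + \<theta>\<^sub>E\<^sub>R e * hat_PR u"
      using sys PF by (simp add: algebra_simps)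
    then show ?thesis
      using shares(10) unfolding p_def by algebra
  qed
  \<comment> \<open>With the final good as numeraire, its zero-profit condition minus its production
    function is a relation between input prices alone, which ties \<open>w\<close> to
    \<open>p\<close>.\<close>
  have w: "w = - \<theta>\<^sub>X\<^sub>E e * \<theta>\<^sub>E\<^sub>R e * p"
  proof -
    have "0 = \<theta>\<^sub>X\<^sub>K e * w + \<theta>\<^sub>X\<^sub>E e * hat_PE u"
      using sys unfolding w_def by (simp add: algebra_simps)
    then show ?thesis
      using PE shares(7) by algebra
  qed
  have R: "hat_R u = \<theta>\<^sub>R\<^sub>K e * hat_KR u"
    using sys by blast
  have F: "hat_F u = hat_R u + \<sigma>\<^sub>E * p"
  proof -
    have "hat_R u - hat_F u = \<sigma>\<^sub>E * (w - hat_PR u)"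
      using sys unfolding PF by blast
    then show ?thesis
      unfolding p_def by (simp add: algebra_simps)
  qed
  have E: "hat_E u = \<theta>\<^sub>E\<^sub>F e * hat_F u + \<theta>\<^sub>E\<^sub>R e * hat_R u"
    using sys by blast
  have KX: "hat_KX u = hat_E u + \<sigma>\<^sub>X * \<theta>\<^sub>E\<^sub>R e * p"
  proof -
    have "hat_KX u - hat_E u = \<sigma>\<^sub>X * (hat_PE u - w)"
      using sys unfolding w_def by (simp add: algebra_simps)
    then show ?thesis
      using PE by simp
  qed
  \<comment> \<open>The capital constraint again reads \<open>B * hat_KR u + C * p = 0\<close>, and
    \<open>B\<close> is positive.\<close>
  have KR: "hat_KR u = - C * p / B"
  proof -
    have "0 = \<alpha>\<^sub>X e * hat_KX u + \<alpha>\<^sub>R e * hat_KR u + \<alpha>\<^sub>F e * hat_F u"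
      using sys by metis
    then have "B * hat_KR u = - C * p"
      using KX E F R shares(4,10,13) unfolding coeff_B_def coeff_C_def by algebra
    then show ?thesis
      using B_pos by (simp add: field_simps)
  qed
  have PQ: "hat_PQ u = w + hat_KR u / \<sigma>\<^sub>R"
  proof -
    have "hat_KR u = \<sigma>\<^sub>R * (hat_PQ u - w)"
      using sys unfolding w_def by (simp add: algebra_simps)
    then show ?thesis
      using \<sigma>\<^sub>R_pos by simp
  qed
  have p: "p = relative_price"
  proof -
    have "(1 - \<gamma> e) * hat_PR u + \<gamma> e * hat_s + hat_R u =
        \<theta>\<^sub>R\<^sub>K e * (w + hat_KR u) + \<theta>\<^sub>R\<^sub>Q e * hat_PQ u"
      using sys unfolding w_def by blast
    moreover have "hat_PR u = p + w"
      unfolding p_def by simp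
    ultimately have "(1 - \<gamma> e) * p + \<gamma> e * \<theta>\<^sub>X\<^sub>E e * \<theta>\<^sub>E\<^sub>R e * p + \<gamma> e * hat_s =
        \<theta>\<^sub>R\<^sub>Q e * (hat_KR u / \<sigma>\<^sub>R)"
      using R PQ w shares(13) by algebra
    then show ?thesis
      unfolding KR eq_relative_price_iff .
  qed
  \<comment> \<open>Only the budget separates \<open>hat_t\<close> from \<open>hat_PK\<close>; with
    \<open>w\<close> known it is linear in \<open>hat_t\<close> with coefficient
    \<open>\<psi> e - 1\<close>.\<close>
  have t: "hat_t u = (hat_s + hat_R u - w) / (\<psi> e - 1)"
  proof -
    have "hat_s + hat_R u = \<psi> e * hat_t u + (w - hat_t u)"
      using sys unfolding w_def by linarith
    then show ?thesis
      using shares(16) by (simp add: eq_divide_eq algebra_simps)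
  qed
  have PK: "hat_PK u = w - hat_t u" and PR: "hat_PR u = w + p"
    unfolding w_def p_def by simp_all
  have X: "hat_X u = \<theta>\<^sub>X\<^sub>K e * hat_KX u + \<theta>\<^sub>X\<^sub>E e * hat_E u" and KF: "hat_KF u = hat_F u"
    and PX: "hat_PX u = 0"
    using sys by simp_all
  show ?thesis
    unfolding equilibrium_response_def Let_def
    \<comment> \<open>Field by field, the equations act as rewrite rules that reduce everything to
      \<open>relative_price\<close> and the parameters.\<close>
    by (rule changes.equality,
        simp_all only: X KF PX PK PR t PQ PF PE KX E F R KR w p changes.simps) simp
qed

lemma ex1_loglinear_system: "\<exists>!u. loglinear_system e \<sigma>\<^sub>X \<sigma>\<^sub>E \<sigma>\<^sub>R hat_s u"
  using loglinear_system_equilibrium_response loglinear_system_imp_equilibrium_response by blast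

lemma solution_eq: "solution e \<sigma>\<^sub>X \<sigma>\<^sub>E \<sigma>\<^sub>R hat_s = equilibrium_response"
  unfolding solution_def
  using loglinear_system_equilibrium_response loglinear_system_imp_equilibrium_response
  by (rule the_equality)

text \<open>Fossil energy follows renewables through \<open>r\<close>, a multiple of
  \<open>- C * p / B\<close>, plus the substitution term \<open>\<sigma>\<^sub>E * p\<close>; the
  common factor \<open>p\<close> is negative.\<close>

lemma hat_F_solution:
  "hat_F (solution e \<sigma>\<^sub>X \<sigma>\<^sub>E \<sigma>\<^sub>R hat_s) = relative_price * (\<sigma>\<^sub>E - \<theta>\<^sub>R\<^sub>K e * C / B)"
  unfolding solution_eq equilibrium_response_def Let_def by (simp add: algebra_simps)

lemma hat_F_pos_iff:
  "hat_F (solution e \<sigma>\<^sub>X \<sigma>\<^sub>E \<sigma>\<^sub>R hat_s) > 0 \<longleftrightarrow> \<theta>\<^sub>R\<^sub>K e * C / B > \<sigma>\<^sub>E"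
  unfolding hat_F_solution using relative_price_neg by (auto simp: zero_less_mult_iff)

lemma hat_F_neg_iff:
  "hat_F (solution e \<sigma>\<^sub>X \<sigma>\<^sub>E \<sigma>\<^sub>R hat_s) < 0 \<longleftrightarrow> \<sigma>\<^sub>E > \<theta>\<^sub>R\<^sub>K e * C / B"
  unfolding hat_F_solution using relative_price_neg by (auto simp: mult_less_0_iff)

lemma threshold_pos: "\<theta>\<^sub>R\<^sub>K e * C / B > 0"
  using shares B_pos C_pos by simp

end

theorem proposition1:
  fixes e :: levels and \<sigma>\<^sub>X \<sigma>\<^sub>R hat_s :: real
  assumes "initial_equilibrium e"
    and "\<sigma>\<^sub>X \<ge> 0" and "\<sigma>\<^sub>R \<ge> 0"
    and "\<sigma>\<^sub>X \<noteq> 0" and "\<sigma>\<^sub>R \<noteq> 0"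
    and "hat_s > 0"
  shows "(\<forall>\<sigma>\<^sub>E\<ge>0. coeff_C e \<sigma>\<^sub>X \<sigma>\<^sub>E \<noteq> 0) \<and>
    (\<forall>\<sigma>\<^sub>E\<ge>0. \<exists>!u. loglinear_system e \<sigma>\<^sub>X \<sigma>\<^sub>E \<sigma>\<^sub>R hat_s u) \<and>
    (\<exists>\<sigma>\<^sub>E>0. hat_F (solution e \<sigma>\<^sub>X \<sigma>\<^sub>E \<sigma>\<^sub>R hat_s) > 0) \<and>
    {\<sigma>\<^sub>E. \<sigma>\<^sub>E \<ge> 0 \<and> hat_F (solution e \<sigma>\<^sub>X \<sigma>\<^sub>E \<sigma>\<^sub>R hat_s) > 0} =
      {\<sigma>\<^sub>E. \<theta>\<^sub>R\<^sub>K e * coeff_C e \<sigma>\<^sub>X \<sigma>\<^sub>E / coeff_B e > \<sigma>\<^sub>E \<and> \<sigma>\<^sub>E \<ge> 0} \<and>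
    (\<forall>\<sigma>\<^sub>E\<ge>0. hat_F (solution e \<sigma>\<^sub>X \<sigma>\<^sub>E \<sigma>\<^sub>R hat_s) < 0 \<longleftrightarrow>
       \<sigma>\<^sub>E > \<theta>\<^sub>R\<^sub>K e * coeff_C e \<sigma>\<^sub>X \<sigma>\<^sub>E / coeff_B e \<and>
       \<theta>\<^sub>R\<^sub>K e * coeff_C e \<sigma>\<^sub>X \<sigma>\<^sub>E / coeff_B e > 0)"
proof -
  have model: "renewable_subsidy e \<sigma>\<^sub>X \<sigma>\<^sub>E \<sigma>\<^sub>R hat_s" if "\<sigma>\<^sub>E \<ge> 0" for \<sigma>\<^sub>E
    using assms that by unfold_locales simp_all
  note C_pos = renewable_subsidy.C_pos[OF model]
  note ex1 = renewable_subsidy.ex1_loglinear_system[OF model]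
  note F_pos = renewable_subsidy.hat_F_pos_iff[OF model]
  note F_neg = renewable_subsidy.hat_F_neg_iff[OF model]
  note threshold = renewable_subsidy.threshold_pos[OF model]
  note shares = initial_equilibrium_shares[OF assms(1)]
  have "\<exists>\<sigma>\<^sub>E>0. hat_F (solution e \<sigma>\<^sub>X \<sigma>\<^sub>E \<sigma>\<^sub>R hat_s) > 0"
  proof (intro exI conjI)
    \<comment> \<open>The threshold itself moves with \<open>\<sigma>\<^sub>E\<close> through
      \<open>C\<close>. As \<open>C\<close> is nondecreasing in \<open>\<sigma>\<^sub>E\<close>,
      half of the threshold at zero stays strictly below the threshold at that point.\<close>
    define \<sigma> where "\<sigma> = \<theta>\<^sub>R\<^sub>K e * coeff_C e \<sigma>\<^sub>X 0 / coeff_B e / 2"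
    show pos: "\<sigma> > 0"
      using threshold[of 0] unfolding \<sigma>_def by simp
    have "coeff_C e \<sigma>\<^sub>X 0 \<le> coeff_C e \<sigma>\<^sub>X \<sigma>"
      unfolding coeff_C_def using shares pos by simp
    then have "\<theta>\<^sub>R\<^sub>K e * coeff_C e \<sigma>\<^sub>X 0 / coeff_B e \<le> \<theta>\<^sub>R\<^sub>K e * coeff_C e \<sigma>\<^sub>X \<sigma> / coeff_B e"
      using shares renewable_subsidy.B_pos[OF model[of 0]]
      by (intro divide_right_mono mult_left_mono) simp_all
    moreover have "\<sigma> < \<theta>\<^sub>R\<^sub>K e * coeff_C e \<sigma>\<^sub>X 0 / coeff_B e"
      using pos unfolding \<sigma>_def by linarith
    ultimately show "hat_F (solution e \<sigma>\<^sub>X \<sigma> \<sigma>\<^sub>R hat_s) > 0"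
      using F_pos[of \<sigma>] pos by simp
  qed
  moreover have "\<forall>\<sigma>\<^sub>E\<ge>0. coeff_C e \<sigma>\<^sub>X \<sigma>\<^sub>E \<noteq> 0"
    using C_pos by (metis less_irrefl)
  ultimately show ?thesis
    using ex1 F_pos F_neg threshold by blast
qed

end
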